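(* Let $p_0=1$, $p_1=p_2\in(1/2,1)$, and $p_3=0$. Let $\mu_B^N$ (resp., $\mu_C^N$) denote the mean profit per turn to the ensemble of $N\ge3$ players always playing game $B$ (resp., game $C$). Then $\mu_B^N=0$ for all even $N\ge4$, $\mu_B^N>0$ for all odd $N\ge3$, and $\mu_C^N>0$ for all $N\ge3$. In particular, the Parrondo effect (that is, $\mu_B^N\le0$ and $\mu_C^N>0$) is present if and only if $N$ is even.
   Context: The $N$-player model with parameters $p_0,p_1,p_2,p_3\in[0,1]$ and $N\ge3$ (game $B$). Players $1,\dots,N$ are arranged in a circle (player $0$ is player $N$, player $N+1$ is player $1$), and each has a status $x_i\in\{0,1\}$ (0 = loser, 1 = winner of his most recent game). At each turn one player $i$ is chosen uniformly at random, independently of the past. With $m_i(\boldsymbol x):=2x_{i-1}+x_{i+1}\in\{0,1,2,3\}$, he wins one unit (and his status becomes 1) with probability $p_{m_i(\boldsymbol x)}$, and loses one unit (and his status becomes 0) with probability $1-p_{m_i(\boldsymbol x)}$. Let $S_n$ be the total profit of the $N$ players after $n$ turns. The mean profit per turn is the constant $\mu$ such that $n^{-1}S_n\to\mu$ almost surely as $n\to\infty$, for every initial distribution of the statuses. Game $C$ is the equally weighted random mixture of game $B$ with the game with all parameters equal to $1/2$; that is, game $C$ is the model just described with each $p_m$ replaced by $(1/2+p_m)/2$, $m=0,1,2,3$. *)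

theory Defs
  imports "HOL-Probability.Probability"
begin

text \<open>
  The players of a configuration \<open>x\<close> are \<open>0, \<dots>, length x - 1\<close>, arranged in a circle;
  player \<open>0\<close> plays the role of player \<open>N\<close>. The entry \<open>x ! i\<close> is \<open>True\<close> iff player \<open>i\<close> is a
  winner (status 1).
\<close>

definition neighbour_index :: "bool list \<Rightarrow> nat \<Rightarrow> nat" where
  "neighbour_index x i =
     2 * of_bool (x ! ((i + length x - 1) mod length x)) + of_bool (x ! ((i + 1) mod length x))"

definition record_result :: "bool list \<Rightarrow> nat \<Rightarrow> bool \<Rightarrow> bool list \<times> int" where
  "record_result x i won = (x[i := won], if won then 1 else - 1)"

text \<open>
  The randomness of one turn: the chosen player, and the results of one toss of each of four
  independent coins, coin \<open>m\<close> showing heads with probability \<open>p m\<close>. The chosen player \<open>i\<close> uses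
  only coin \<open>neighbour_index x i\<close>; the other three are ignored. Tossing all four makes the law of
  the randomness independent of the configuration, so that the whole game is driven by an i.i.d.
  sequence.
\<close>

definition coins :: "(nat \<Rightarrow> real) \<Rightarrow> bool list pmf" where
  "coins p =
     bind_pmf (bernoulli_pmf (p 0)) (\<lambda>c0.
     bind_pmf (bernoulli_pmf (p 1)) (\<lambda>c1.
     bind_pmf (bernoulli_pmf (p 2)) (\<lambda>c2.
     bind_pmf (bernoulli_pmf (p 3)) (\<lambda>c3. return_pmf [c0, c1, c2, c3]))))"

definition turn_input :: "nat \<Rightarrow> (nat \<Rightarrow> real) \<Rightarrow> (nat \<times> bool list) pmf" where
  "turn_input N p = pair_pmf (pmf_of_set {..<N}) (coins p)"

definition play_turn :: "bool list \<Rightarrow> nat \<times> bool list \<Rightarrow> bool list \<times> int" where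
  "play_turn x = (\<lambda>(i, c). record_result x i (c ! neighbour_index x i))"

lemma map_nth_coins:
  assumes "m < 4"
  shows "map_pmf (\<lambda>c. c ! m) (coins p) = bernoulli_pmf (p m)"
proof -
  have "m = 0 \<or> m = 1 \<or> m = 2 \<or> m = 3"
    using assms by auto
  then show ?thesis
    by (auto simp: coins_def map_bind_pmf bind_return_pmf')
qed

text \<open>The resulting one-turn transition law.\<close>

lemma map_play_turn:
  "map_pmf (play_turn x) (turn_input N p) =
     bind_pmf (pmf_of_set {..<N}) (\<lambda>i.
       map_pmf (record_result x i) (bernoulli_pmf (p (neighbour_index x i))))"
proof -
  have "map_pmf (record_result x i) (bernoulli_pmf (p (neighbour_index x i))) =
      map_pmf (\<lambda>c. play_turn x (i, c)) (coins p)" for i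
  proof -
    have "neighbour_index x i < 4"
      by (simp add: neighbour_index_def)
    then have "map_pmf (record_result x i) (bernoulli_pmf (p (neighbour_index x i))) =
        map_pmf (record_result x i) (map_pmf (\<lambda>c. c ! neighbour_index x i) (coins p))"
      by (simp only: map_nth_coins)
    then show ?thesis
      by (simp add: pmf.map_comp o_def play_turn_def)
  qed
  then show ?thesis
    by (simp add: turn_input_def pair_pmf_def map_bind_pmf map_pmf_def bind_assoc_pmf bind_return_pmf)
qed

primrec configuration :: "bool list \<Rightarrow> (nat \<times> bool list) stream \<Rightarrow> nat \<Rightarrow> bool list" where
  "configuration x \<omega> 0 = x"
| "configuration x \<omega> (Suc n) = fst (play_turn (configuration x \<omega> n) (\<omega> !! n))"

definition total_profit :: "bool list \<Rightarrow> (nat \<times> bool list) stream \<Rightarrow> nat \<Rightarrow> int" where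
  "total_profit x \<omega> n = (\<Sum>k<n. snd (play_turn (configuration x \<omega> k) (\<omega> !! k)))"

text \<open>
  The initial configuration has law \<open>init\<close> and is independent of the i.i.d. inputs of the turns.
\<close>

definition game_space ::
    "nat \<Rightarrow> (nat \<Rightarrow> real) \<Rightarrow> bool list pmf \<Rightarrow> (bool list \<times> (nat \<times> bool list) stream) measure" where
  "game_space N p init = measure_pmf init \<Otimes>\<^sub>M stream_space (measure_pmf (turn_input N p))"

definition has_mean_profit :: "nat \<Rightarrow> (nat \<Rightarrow> real) \<Rightarrow> real \<Rightarrow> bool" where
  "has_mean_profit N p \<mu> \<longleftrightarrow>
     (\<forall>init. set_pmf init \<subseteq> {x. length x = N} \<longrightarrow>
       (AE (x, \<omega>) in game_space N p init.
          (\<lambda>n. real_of_int (total_profit x \<omega> n) / real n) \<longlonglongrightarrow> \<mu>))"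

definition mean_profit :: "nat \<Rightarrow> (nat \<Rightarrow> real) \<Rightarrow> real" where
  "mean_profit N p = (THE \<mu>. has_mean_profit N p \<mu>)"

definition mixed_game :: "(nat \<Rightarrow> real) \<Rightarrow> nat \<Rightarrow> real" where
  "mixed_game p m = (1 / 2 + p m) / 2"

definition parrondo_effect :: "nat \<Rightarrow> (nat \<Rightarrow> real) \<Rightarrow> bool" where
  "parrondo_effect N p \<longleftrightarrow> mean_profit N p \<le> 0 \<and> mean_profit N (mixed_game p) > 0"

end

theory Submission
  imports Defs
begin

text \<open>
  Let \<open>P\<close> (\<open>next_mean\<close>) be the operator that averages a function of the configuration over one
  turn, \<open>g\<close> (\<open>drift\<close>) the mean profit of the next turn, \<open>k\<close> (\<open>winners\<close>) the number of winners, and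
  \<open>D\<close> (\<open>discord\<close>) the number of players whose two neighbours have different statuses. Games \<open>B\<close>
  and \<open>C\<close> both satisfy \<open>p\<^sub>0 + p\<^sub>3 = 1\<close> and \<open>p\<^sub>1 = p\<^sub>2\<close>, so the expected result of a player against
  statuses \<open>l\<close> and \<open>r\<close> is \<open>(2 p\<^sub>0 - 1) (1 - l - r) + (2 p\<^sub>1 - 1) [l \<noteq> r]\<close>. Summed around the circle
  this expresses \<open>N g\<close> by \<open>N - 2 k\<close> and \<open>D\<close>. On the other hand a player's win sets his status to 1
  and his loss sets it to 0, so the expected change \<open>P k - k\<close> is also determined by \<open>g\<close> and \<open>k\<close>.
  Eliminating \<open>k\<close> gives \<open>g = \<alpha> (P k - k) + \<beta> D\<close> with a constant \<open>\<alpha>\<close> and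
  \<open>\<beta> = (2 p\<^sub>1 - 1) / (2 p\<^sub>0 N) > 0\<close> (\<open>drift_eq\<close>). The first summand telescopes along the game, hence
  the profit per turn is asymptotically \<open>\<beta>\<close> times the time average of \<open>D \<ge> 0\<close>: its sign is decided
  by whether discord persists.

  Discord dies out exactly in game \<open>B\<close> with \<open>N\<close> even. There the two alternating configurations are
  absorbing and free of discord, and they are reached from everywhere by a single round in which
  every player takes the status opposite to his predecessor's: against a losing predecessor he wins
  with probability \<open>p\<^sub>0\<close> or \<open>p\<^sub>1\<close>, against a winning one he loses with probability \<open>1 - p\<^sub>2\<close> or
  \<open>1 - p\<^sub>3\<close>, all of which are positive. For odd \<open>N\<close> the same rounds lead to one fixed configuration,
  whose alternation has a defect and hence discord; in game \<open>C\<close> every configuration is reached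
  from every other one. A configuration that is visited from everywhere with a uniformly positive
  probability in a fixed number of turns forces \<open>P\<^sup>n D\<close> to converge to a constant
  (\<open>iterate_converges\<close>), which is positive if \<open>D\<close> is positive there.

  The almost sure limit comes from an approximate Poisson equation: if \<open>g + P h - h\<close> is within
  \<open>\<epsilon>\<close> of \<open>\<mu>\<close> on all configurations, then profit plus \<open>h\<close> grows at rate \<open>\<mu> \<plusminus> \<epsilon>\<close>, by an
  exponential moment bound and the Borel--Cantelli lemma (\<open>AE_profit_upper_bound\<close>,
  \<open>has_mean_profitI\<close>). With \<open>h = - \<alpha> k + \<beta> (D + P D + \<dots> + P\<^sup>n\<^sup>-\<^sup>1 D)\<close> the sum \<open>g + P h - h\<close>
  collapses to \<open>\<beta> P\<^sup>n D\<close>, so uniform convergence of \<open>P\<^sup>n D\<close> is all that is required; no stationary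
  distribution has to be found, and two absorbing states do no harm.
\<close>

section \<open>Averaging over one turn\<close>

lemma set_pmf_turn_input_finite: "N > 0 \<Longrightarrow> finite (set_pmf (turn_input N p))"
  by (auto simp: turn_input_def coins_def set_pmf_of_set lessThan_empty_iff intro!: finite_SigmaI)

lemma expectation_play_turn:
  fixes F :: "bool list \<times> int \<Rightarrow> real"
  assumes "N > 0" and p: "\<And>m. m < 4 \<Longrightarrow> p m \<in> {0..1}"
  shows "measure_pmf.expectation (turn_input N p) (\<lambda>u. F (play_turn x u)) =
    (\<Sum>i<N. p (neighbour_index x i) * F (x[i := True], 1)
           + (1 - p (neighbour_index x i)) * F (x[i := False], - 1)) / real N"
proof -
  have m: "neighbour_index x i < 4" for i
    by (simp add: neighbour_index_def)
  have "measure_pmf.expectation (turn_input N p) (\<lambda>u. F (play_turn x u)) =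
      measure_pmf.expectation (map_pmf (play_turn x) (turn_input N p)) F"
    by simp
  also have "\<dots> = measure_pmf.expectation (bind_pmf (pmf_of_set {..<N}) (\<lambda>i.
       map_pmf (record_result x i) (bernoulli_pmf (p (neighbour_index x i))))) F"
    by (simp only: map_play_turn)
  also have "\<dots> = (\<Sum>i<N. measure_pmf.expectation
       (map_pmf (record_result x i) (bernoulli_pmf (p (neighbour_index x i)))) F) / real N"
    using assms(1)
    by (subst pmf_expectation_bind_pmf_of_set)
      (auto simp: divide_inverse lessThan_empty_iff sum_distrib_left sum_distrib_right mult_ac)
  also have "\<dots> = (\<Sum>i<N. p (neighbour_index x i) * F (x[i := True], 1)
           + (1 - p (neighbour_index x i)) * F (x[i := False], - 1)) / real N"
    using p[OF m] by (simp add: record_result_def mult.commute)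
  finally show ?thesis .
qed

definition configurations :: "nat \<Rightarrow> bool list set" where
  "configurations N = {x. length x = N}"

definition next_mean :: "nat \<Rightarrow> (nat \<Rightarrow> real) \<Rightarrow> (bool list \<Rightarrow> real) \<Rightarrow> bool list \<Rightarrow> real" where
  "next_mean N p f x = measure_pmf.expectation (turn_input N p) (\<lambda>u. f (fst (play_turn x u)))"

lemma finite_configurations: "finite (configurations N)"
  using finite_lists_length_eq[of "UNIV::bool set" N] by (simp add: configurations_def)

lemma configurations_nonempty: "configurations N \<noteq> {}"
  unfolding configurations_def using length_replicate by fastforce

lemma length_play_turn [simp]: "length (fst (play_turn x u)) = length x"
  by (simp add: play_turn_def record_result_def split: prod.split)

lemma play_turn_in_configurations:
  "x \<in> configurations N \<Longrightarrow> fst (play_turn x u) \<in> configurations N"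
  by (simp add: configurations_def)

lemma abs_profit_le_1: "\<bar>real_of_int (snd (play_turn x u))\<bar> \<le> 1"
  by (simp add: play_turn_def record_result_def split: prod.split)

context
  fixes N :: nat and p :: "nat \<Rightarrow> real"
  assumes N: "N > 0"
begin

lemma integrable_turn_input: "integrable (measure_pmf (turn_input N p)) (f :: _ \<Rightarrow> real)"
  using set_pmf_turn_input_finite[OF N] by (rule integrable_measure_pmf_finite)

lemma next_mean_mono:
  assumes "\<And>y. y \<in> configurations N \<Longrightarrow> f y \<le> g y" and "x \<in> configurations N"
  shows "next_mean N p f x \<le> next_mean N p g x"
  unfolding next_mean_def
  by (intro integral_mono integrable_turn_input assms play_turn_in_configurations)

lemma next_mean_const [simp]: "next_mean N p (\<lambda>_. c) x = c"
  by (simp add: next_mean_def)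

lemma next_mean_add:
  "next_mean N p (\<lambda>y. f y + g y) x = next_mean N p f x + next_mean N p g x"
  by (simp add: next_mean_def integrable_turn_input)

lemma next_mean_cmult: "next_mean N p (\<lambda>y. c * f y) x = c * next_mean N p f x"
  by (simp add: next_mean_def)

lemma next_mean_sum:
  "next_mean N p (\<lambda>y. \<Sum>i\<in>I. f i y) x = (\<Sum>i\<in>I. next_mean N p (f i) x)"
  by (simp add: next_mean_def integrable_turn_input)

lemma iterate_mono:
  assumes "\<And>y. y \<in> configurations N \<Longrightarrow> f y \<le> g y" and "x \<in> configurations N"
  shows "(next_mean N p ^^ n) f x \<le> (next_mean N p ^^ n) g x"
  using assms(2)
proof (induction n arbitrary: x)
  case (Suc n)
  then show ?case by (auto intro!: next_mean_mono)
qed (simp add: assms)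

lemma iterate_affine:
  "(next_mean N p ^^ n) (\<lambda>y. c * f y + d) x = c * (next_mean N p ^^ n) f x + d"
proof (induction n arbitrary: x)
  case (Suc n)
  have "(next_mean N p ^^ n) (\<lambda>y. c * f y + d) = (\<lambda>x. c * (next_mean N p ^^ n) f x + d)"
    using Suc by blast
  then show ?case by (simp add: next_mean_add next_mean_cmult)
qed simp

lemma iterate_const: "(next_mean N p ^^ n) (\<lambda>_. c) x = c"
  using iterate_affine[of n 0 "\<lambda>_. 0" c x] by simp

lemma iterate_ge:
  assumes "\<And>y. y \<in> configurations N \<Longrightarrow> a \<le> f y" and "x \<in> configurations N"
  shows "a \<le> (next_mean N p ^^ n) f x"
  using iterate_mono[of "\<lambda>_. a" f x n] assms by (simp add: iterate_const)

lemma iterate_le: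
  assumes "\<And>y. y \<in> configurations N \<Longrightarrow> f y \<le> b" and "x \<in> configurations N"
  shows "(next_mean N p ^^ n) f x \<le> b"
  using iterate_mono[of f "\<lambda>_. b" x n] assms by (simp add: iterate_const)

section \<open>Convergence of the iterated averages\<close>

text \<open>
  The maximum of \<open>P\<^sup>n f\<close> decreases in \<open>n\<close> and the minimum increases. After \<open>L\<close> further turns every
  value has been averaged, with weight at least \<open>\<delta>\<close>, with the common value on \<open>Z\<close>, so the gap
  between maximum and minimum is multiplied by at most \<open>1 - \<delta>\<close> and both limits agree. A whole set
  \<open>Z\<close> is allowed, rather than a single configuration, because game \<open>B\<close> has two absorbing states
  for even \<open>N\<close>.
\<close>

lemma iterate_converges:
  assumes \<delta>: "\<delta> > 0"
    and visit: "\<And>x. x \<in> configurations N \<Longrightarrow> \<exists>z\<in>Z. \<forall>g. (\<forall>y\<in>configurations N. 0 \<le> g y) \<longrightarrow>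
        \<delta> * g z \<le> (next_mean N p ^^ L) g x"
    and const: "\<And>n z z'. z \<in> Z \<Longrightarrow> z' \<in> Z \<Longrightarrow> (next_mean N p ^^ n) f z = (next_mean N p ^^ n) f z'"
  obtains c where "\<And>x. x \<in> configurations N \<Longrightarrow> (\<lambda>n. (next_mean N p ^^ n) f x) \<longlonglongrightarrow> c"
proof -
  define S where "S = configurations N"
  define F where "F n = (next_mean N p ^^ n) f" for n
  define u where "u n = Max (F n ` S)" for n
  define l where "l n = Min (F n ` S)" for n
  have S: "finite S" "S \<noteq> {}"
    using finite_configurations configurations_nonempty by (auto simp: S_def)
  have F_add: "F (m + n) = (next_mean N p ^^ m) (F n)" for m n
    by (simp add: F_def funpow_add)
  have le: "l n \<le> F n x" "F n x \<le> u n" if "x \<in> S" for n x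
    using that S by (auto simp: l_def u_def)
  have lu: "l n \<le> u n" for n
    using S le by (meson equals0I order_trans)
  have step: "l n \<le> F (m + n) x" "F (m + n) x \<le> u n" if "x \<in> S" for m n x
    unfolding F_add by (intro iterate_ge iterate_le; use le that in \<open>simp add: S_def\<close>)+
  have u_mem: "\<exists>x\<in>S. u n = F n x" and l_mem: "\<exists>x\<in>S. l n = F n x" for n
    using Max_in[of "F n ` S"] Min_in[of "F n ` S"] S unfolding u_def l_def by blast+
  have u_dec: "u (m + n) \<le> u n" for m n
  proof -
    obtain x where "x \<in> S" "u (m + n) = F (m + n) x"
      using u_mem by blast
    then show ?thesis using step(2) by simp
  qed
  have l_inc: "l n \<le> l (m + n)" for m n
  proof -
    obtain x where "x \<in> S" "l (m + n) = F (m + n) x"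
      using l_mem by blast
    then show ?thesis using step(1) by simp
  qed
  have "decseq u"
    using u_dec[of 1] by (auto intro!: decseq_SucI)
  moreover have "l 0 \<le> u n" for n
    using l_inc[of 0 n] lu[of n] by simp
  ultimately obtain U where U: "u \<longlonglongrightarrow> U"
    using decseq_convergent by blast
  have "incseq l"
    using l_inc[of _ 1] by (auto intro!: incseq_SucI)
  moreover have "l n \<le> u 0" for n
    using u_dec[of n 0] lu[of n] by simp
  ultimately obtain V where V: "l \<longlonglongrightarrow> V"
    using incseq_convergent by blast
  obtain z where z: "z \<in> Z"
    using S(2) visit unfolding S_def by (meson ex_in_conv)
  have "u (L + n) - l (L + n) \<le> (1 - \<delta>) * (u n - l n)" for n
  proof -
    have upper: "F (L + n) x \<le> u n - \<delta> * (u n - F n z)"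
      and lower: "l n + \<delta> * (F n z - l n) \<le> F (L + n) x" if "x \<in> S" for x
    proof -
      obtain z' where z': "z' \<in> Z" and visit': "\<forall>g. (\<forall>y\<in>configurations N. 0 \<le> g y) \<longrightarrow>
          \<delta> * g z' \<le> (next_mean N p ^^ L) g x"
        using visit \<open>x \<in> S\<close> unfolding S_def by blast
      have v: "\<delta> * g z' \<le> (next_mean N p ^^ L) g x" if "\<And>y. y \<in> S \<Longrightarrow> 0 \<le> g y" for g
        using visit' that by (simp add: S_def)
      have eq: "F n z' = F n z"
        unfolding F_def by (rule const[OF z' z])
      \<comment> \<open>Both \<open>u n - F n\<close> and \<open>F n - l n\<close> are nonnegative affine images of \<open>F n\<close>.\<close>
      have "\<delta> * (- 1 * F n z' + u n) \<le> (next_mean N p ^^ L) (\<lambda>y. - 1 * F n y + u n) x"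
        by (rule v) (simp add: le(2))
      also have "\<dots> = - 1 * F (L + n) x + u n"
        by (simp only: iterate_affine F_add)
      finally show "F (L + n) x \<le> u n - \<delta> * (u n - F n z)"
        by (simp add: eq algebra_simps)
      have "\<delta> * (1 * F n z' + - l n) \<le> (next_mean N p ^^ L) (\<lambda>y. 1 * F n y + - l n) x"
        by (rule v) (simp add: le(1))
      also have "\<dots> = 1 * F (L + n) x + - l n"
        by (simp only: iterate_affine F_add)
      finally show "l n + \<delta> * (F n z - l n) \<le> F (L + n) x"
        by (simp add: eq algebra_simps)
    qed
    obtain x y where "x \<in> S" "u (L + n) = F (L + n) x" "y \<in> S" "l (L + n) = F (L + n) y"
      using u_mem l_mem by blast
    then show ?thesis
      using upper[of x] lower[of y] by (simp add: algebra_simps)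
  qed
  moreover have "(\<lambda>n. u (L + n) - l (L + n)) \<longlonglongrightarrow> U - V"
    using LIMSEQ_ignore_initial_segment[OF U, of L] LIMSEQ_ignore_initial_segment[OF V, of L]
    by (auto simp: add.commute intro: tendsto_diff)
  moreover have "(\<lambda>n. (1 - \<delta>) * (u n - l n)) \<longlonglongrightarrow> (1 - \<delta>) * (U - V)"
    by (intro tendsto_intros U V)
  ultimately have "U - V \<le> (1 - \<delta>) * (U - V)"
    using LIMSEQ_le by blast
  then have "\<delta> * (U - V) \<le> 0"
    by (simp add: algebra_simps)
  then have "U \<le> V"
    using \<delta> by (simp add: mult_le_0_iff)
  moreover have "V \<le> U"
    using LIMSEQ_le[OF V U] lu by blast
  ultimately have "U = V"
    by simp
  have "(\<lambda>n. F n x) \<longlonglongrightarrow> U" if "x \<in> S" for x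
    by (rule tendsto_sandwich[of l _ _ u]) (use le that U V \<open>U = V\<close> in auto)
  then show thesis
    by (intro that[of U]) (simp add: F_def S_def)
qed

end

section \<open>A law of large numbers for the total profit\<close>

lemma exp_le_one_plus_plus_square:
  fixes x :: real
  assumes "\<bar>x\<bar> \<le> 1"
  shows "exp x \<le> 1 + x + x\<^sup>2"
proof (cases "0 \<le> x")
  case True
  then show ?thesis using exp_bound assms by simp
next
  case False
  define y where "y = - x"
  have y: "0 \<le> y" "y \<le> 1" using False assms by (auto simp: y_def)
  \<comment> \<open>The product is \<open>1 + y\<^sup>3\<close>.\<close>
  have "1 \<le> (1 - y + y\<^sup>2) * (1 + y)"
    using y by (simp add: algebra_simps power2_eq_square)
  also have "\<dots> \<le> (1 - y + y\<^sup>2) * exp y"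
  proof (rule mult_left_mono)
    show "1 + y \<le> exp y" by (rule exp_ge_add_one_self)
    show "0 \<le> 1 - y + y\<^sup>2" using y by (simp add: add_nonneg_nonneg)
  qed
  finally show ?thesis
    by (simp add: y_def exp_minus field_simps)
qed

text \<open>
  Splitting off the first turn, rather than the last one, suits the product structure of the stream
  space: the remaining inputs play the same game from the new configuration.
\<close>

lemma configuration_SCons:
  "configuration x (u ## \<omega>) (Suc n) = configuration (fst (play_turn x u)) \<omega> n"
  by (induction n) simp_all

lemma total_profit_SCons:
  "total_profit x (u ## \<omega>) (Suc n) =
     snd (play_turn x u) + total_profit (fst (play_turn x u)) \<omega> n"
  unfolding total_profit_def
  by (subst sum.lessThan_Suc_shift) (simp add: configuration_SCons del: configuration.simps(2))

lemma configuration_in_configurations: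
  "x \<in> configurations N \<Longrightarrow> configuration x \<omega> n \<in> configurations N"
  by (induction n) (simp_all add: play_turn_in_configurations)

lemma measurable_configuration [measurable]:
  "(\<lambda>\<omega>. configuration x \<omega> n) \<in> measurable (stream_space (measure_pmf K)) (count_space UNIV)"
proof (induction n)
  case (Suc n)
  note [measurable] = Suc
  have "(\<lambda>\<omega>. (configuration x \<omega> n, \<omega> !! n)) \<in> measurable (stream_space (measure_pmf K))
      (count_space UNIV \<Otimes>\<^sub>M count_space UNIV)"
    by measurable
  then have "(\<lambda>\<omega>. (\<lambda>(y, u). fst (play_turn y u)) (configuration x \<omega> n, \<omega> !! n))
      \<in> measurable (stream_space (measure_pmf K)) (count_space UNIV)"
    by (rule measurable_compose) (simp add: pair_measure_countable)
  then show ?case by simp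
qed simp

lemma measurable_total_profit [measurable]:
  "(\<lambda>\<omega>. real_of_int (total_profit x \<omega> n)) \<in> borel_measurable (stream_space (measure_pmf K))"
proof -
  have "(\<lambda>\<omega>. real_of_int (snd (play_turn (configuration x \<omega> k) (\<omega> !! k))))
      \<in> borel_measurable (stream_space (measure_pmf K))" for k
  proof -
    have "(\<lambda>\<omega>. (configuration x \<omega> k, \<omega> !! k)) \<in> measurable (stream_space (measure_pmf K))
        (count_space UNIV \<Otimes>\<^sub>M count_space UNIV)"
      by measurable
    then have "(\<lambda>\<omega>. (\<lambda>(y, u). real_of_int (snd (play_turn y u))) (configuration x \<omega> k, \<omega> !! k))
        \<in> borel_measurable (stream_space (measure_pmf K))"
      by (rule measurable_compose) (simp add: pair_measure_countable)
    then show ?thesis by simp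
  qed
  note [measurable] = this
  show ?thesis unfolding total_profit_def of_int_sum by measurable
qed

text \<open>
  Each turn multiplies the exponential moment by at most
  \<open>E (exp (l Y)) \<le> 1 + l E Y + l\<^sup>2 E (Y\<^sup>2) \<le> exp (l \<gamma> + l\<^sup>2 B\<^sup>2)\<close>, where \<open>Y\<close> is the increment of
  \<open>\<theta> \<sqdot> profit + h\<close>. The bound is uniform in the starting configuration, which is what lets the
  induction split off the first turn. Taking \<open>\<theta> = 1\<close> and \<open>\<theta> = - 1\<close> serves both tails.
\<close>

lemma nn_integral_exp_profit_le:
  fixes h :: "bool list \<Rightarrow> real" and \<theta> :: real
  assumes N: "N > 0"
    and B: "\<And>x u. x \<in> configurations N \<Longrightarrow>
        \<bar>\<theta> * snd (play_turn x u) + h (fst (play_turn x u)) - h x\<bar> \<le> B"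
    and \<gamma>: "\<And>x. x \<in> configurations N \<Longrightarrow> measure_pmf.expectation (turn_input N p)
        (\<lambda>u. \<theta> * snd (play_turn x u) + h (fst (play_turn x u)) - h x) \<le> \<gamma>"
    and l: "0 \<le> l" "l * B \<le> 1"
    and x: "x \<in> configurations N"
  shows "(\<integral>\<^sup>+\<omega>. ennreal (exp (l * (\<theta> * total_profit x \<omega> n + h (configuration x \<omega> n) - h x)))
      \<partial>stream_space (measure_pmf (turn_input N p))) \<le> ennreal (exp (real n * (l * \<gamma> + l\<^sup>2 * B\<^sup>2)))"
  using x
proof (induction n arbitrary: x)
  case 0
  interpret prob_space "stream_space (measure_pmf (turn_input N p))"
    by (rule prob_space.prob_space_stream_space) (rule prob_space_measure_pmf)
  show ?case by (simp add: total_profit_def emeasure_space_1)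
next
  case (Suc n)
  define K where "K = turn_input N p"
  define Y where "Y u = \<theta> * snd (play_turn x u) + h (fst (play_turn x u)) - h x" for u
  define y where "y u = fst (play_turn x u)" for u
  define c where "c = l * \<gamma> + l\<^sup>2 * B\<^sup>2"
  have int: "integrable (measure_pmf K) (f :: _ \<Rightarrow> real)" for f
    unfolding K_def by (rule integrable_turn_input[OF N])
  have one_step: "(\<integral>\<^sup>+u. ennreal (exp (l * Y u)) \<partial>K) \<le> ennreal (exp c)"
  proof -
    have "exp (l * Y u) \<le> 1 + l * Y u + l\<^sup>2 * B\<^sup>2" for u
    proof -
      have Y: "\<bar>Y u\<bar> \<le> B" unfolding Y_def by (rule B) fact
      have "\<bar>l * Y u\<bar> \<le> l * B" using Y l by (simp add: abs_mult mult_left_mono)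
      then have "exp (l * Y u) \<le> 1 + l * Y u + (l * Y u)\<^sup>2"
        using l by (intro exp_le_one_plus_plus_square) simp
      moreover have "(l * Y u)\<^sup>2 \<le> l\<^sup>2 * B\<^sup>2"
        using Y by (simp add: power_mult_distrib abs_le_square_iff[symmetric] mult_left_mono)
      ultimately show ?thesis by simp
    qed
    then have "measure_pmf.expectation K (\<lambda>u. exp (l * Y u))
        \<le> measure_pmf.expectation K (\<lambda>u. 1 + l * Y u + l\<^sup>2 * B\<^sup>2)"
      by (intro integral_mono int)
    also have "\<dots> = 1 + l * measure_pmf.expectation K Y + l\<^sup>2 * B\<^sup>2"
      by (simp add: int)
    also have "\<dots> \<le> 1 + c"
      using \<gamma>[OF Suc.prems] l by (simp add: Y_def[abs_def] K_def c_def mult_left_mono)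
    also have "\<dots> \<le> exp c"
      by (rule exp_ge_add_one_self)
    finally show ?thesis
      by (simp add: nn_integral_eq_integral int)
  qed
  have "(\<integral>\<^sup>+\<omega>. ennreal (exp (l * (\<theta> * total_profit x \<omega> (Suc n) + h (configuration x \<omega> (Suc n)) - h x)))
      \<partial>stream_space (measure_pmf K)) =
    (\<integral>\<^sup>+u. (\<integral>\<^sup>+\<omega>. ennreal (exp (l * (\<theta> * total_profit x (u ## \<omega>) (Suc n)
        + h (configuration x (u ## \<omega>) (Suc n)) - h x))) \<partial>stream_space (measure_pmf K)) \<partial>K)"
    by (subst prob_space.nn_integral_stream_space[OF prob_space_measure_pmf]) (simp_all del: configuration.simps(2))
  also have "\<dots> = (\<integral>\<^sup>+u. ennreal (exp (l * Y u)) * (\<integral>\<^sup>+\<omega>. ennreal (exp (l *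
        (\<theta> * total_profit (y u) \<omega> n + h (configuration (y u) \<omega> n) - h (y u))))
        \<partial>stream_space (measure_pmf K)) \<partial>K)"
    by (intro nn_integral_cong, subst nn_integral_cmult[symmetric])
       (simp_all add: configuration_SCons total_profit_SCons Y_def y_def ennreal_mult'[symmetric]
         exp_add[symmetric] algebra_simps del: configuration.simps(2))
  also have "\<dots> \<le> (\<integral>\<^sup>+u. ennreal (exp (l * Y u)) * ennreal (exp (real n * c)) \<partial>K)"
    using Suc.IH[OF play_turn_in_configurations[OF Suc.prems]]
    by (intro nn_integral_mono mult_left_mono) (simp_all add: K_def y_def c_def)
  also have "\<dots> = (\<integral>\<^sup>+u. ennreal (exp (l * Y u)) \<partial>K) * ennreal (exp (real n * c))"
    by (rule nn_integral_multc) simp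
  also have "\<dots> \<le> ennreal (exp c) * ennreal (exp (real n * c))"
    by (intro mult_right_mono one_step) simp
  also have "\<dots> = ennreal (exp (real (Suc n) * c))"
    by (simp add: ennreal_mult'[symmetric] exp_add[symmetric] algebra_simps)
  finally show ?case by (simp only: K_def c_def)
qed

text \<open>
  For a small \<open>l\<close>, Markov's inequality applied to the exponential moment makes the probability of
  exceeding the rate \<open>\<gamma>\<close> by a fixed amount geometrically small in \<open>n\<close>, and Borel--Cantelli applies.
  The bounded function \<open>h\<close> is negligible after division by \<open>n\<close>.
\<close>

lemma AE_profit_upper_bound:
  fixes h :: "bool list \<Rightarrow> real" and \<theta> :: real
  assumes N: "N > 0" and \<theta>: "\<bar>\<theta>\<bar> \<le> 1"
    and \<gamma>: "\<And>x. x \<in> configurations N \<Longrightarrow> measure_pmf.expectation (turn_input N p)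
        (\<lambda>u. \<theta> * snd (play_turn x u) + h (fst (play_turn x u)) - h x) \<le> \<gamma>"
    and \<gamma>': "\<gamma> < \<gamma>'"
    and x: "x \<in> configurations N"
  shows "AE \<omega> in stream_space (measure_pmf (turn_input N p)).
      eventually (\<lambda>n. \<theta> * (total_profit x \<omega> n / real n) \<le> \<gamma>') sequentially"
proof -
  let ?M = "stream_space (measure_pmf (turn_input N p))"
  interpret prob_space ?M
    by (rule prob_space.prob_space_stream_space) (rule prob_space_measure_pmf)
  define H where "H = Max ((\<lambda>x. \<bar>h x\<bar>) ` configurations N)"
  have H: "\<bar>h y\<bar> \<le> H" if "y \<in> configurations N" for y
    using that finite_configurations by (auto simp: H_def)
  define B where "B = 1 + 2 * H"
  have H0: "0 \<le> H" using H[OF x] by simp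
  have bound: "\<bar>\<theta> * snd (play_turn y u) + h (fst (play_turn y u)) - h y\<bar> \<le> B"
    if "y \<in> configurations N" for y u
  proof -
    have "\<bar>\<theta> * snd (play_turn y u)\<bar> \<le> 1"
      unfolding abs_mult by (rule mult_le_one) (use \<theta> abs_profit_le_1 in auto)
    then show ?thesis
      using H[OF that] H[OF play_turn_in_configurations[OF that], of u] by (auto simp: B_def)
  qed
  \<comment> \<open>Of the three parts of the excess rate, one absorbs the quadratic term of the moment bound,
      one gives the geometric decay, and one absorbs \<open>h\<close>.\<close>
  define \<epsilon> where "\<epsilon> = (\<gamma>' - \<gamma>) / 3"
  have \<epsilon>: "\<epsilon> > 0" using \<gamma>' by (simp add: \<epsilon>_def)
  define l where "l = min (1 / B) (\<epsilon> / B\<^sup>2)"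
  have B1: "B \<ge> 1" using H0 by (simp add: B_def)
  have l: "l > 0" "l * B \<le> 1" "l * B\<^sup>2 \<le> \<epsilon>"
    using \<epsilon> B1 by (auto simp: l_def min_def field_simps)
  define W where "W n \<omega> = l * (\<theta> * total_profit x \<omega> n + h (configuration x \<omega> n) - h x)" for n \<omega>
  define q where "q = exp (- (l * \<epsilon>))"
  have q: "0 < q" "q < 1" using l \<epsilon> by (auto simp: q_def)
  have [measurable]: "W n \<in> borel_measurable ?M" for n
    unfolding W_def by measurable
  define A where "A n = {\<omega> \<in> space ?M. real n * (l * (\<gamma> + 2 * \<epsilon>)) \<le> W n \<omega>}" for n
  have [measurable]: "A n \<in> sets ?M" for n
    unfolding A_def by measurable
  have "prob (A n) \<le> q ^ n" for n
  proof -
    have "emeasure ?M (A n) = (\<integral>\<^sup>+\<omega>. indicator (A n) \<omega> \<partial>?M)"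
      by simp
    also have "\<dots> \<le> (\<integral>\<^sup>+\<omega>. ennreal (exp (- (real n * (l * (\<gamma> + 2 * \<epsilon>))))) * ennreal (exp (W n \<omega>)) \<partial>?M)"
      by (intro nn_integral_mono)
        (auto simp: A_def ennreal_mult'[symmetric] exp_add[symmetric] split: split_indicator)
    also have "\<dots> = ennreal (exp (- (real n * (l * (\<gamma> + 2 * \<epsilon>))))) * (\<integral>\<^sup>+\<omega>. ennreal (exp (W n \<omega>)) \<partial>?M)"
      by (rule nn_integral_cmult) measurable
    also have "\<dots> \<le> ennreal (exp (- (real n * (l * (\<gamma> + 2 * \<epsilon>))))) *
        ennreal (exp (real n * (l * \<gamma> + l\<^sup>2 * B\<^sup>2)))"
      unfolding W_def
      by (intro mult_left_mono nn_integral_exp_profit_le N bound \<gamma> x) (use l in auto)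
    also have "\<dots> = ennreal (exp (real n * (l * (l * B\<^sup>2 - 2 * \<epsilon>))))"
      by (simp add: ennreal_mult'[symmetric] exp_add[symmetric] algebra_simps power2_eq_square)
    also have "\<dots> \<le> ennreal (exp (real n * (l * - \<epsilon>)))"
      unfolding ennreal_le_iff[OF exp_ge_zero] exp_le_cancel_iff using l by (intro mult_left_mono) auto
    also have "exp (real n * (l * - \<epsilon>)) = q ^ n"
      unfolding q_def by (simp add: exp_of_nat_mult[symmetric])
    finally show ?thesis
      using q by (simp add: emeasure_eq_measure)
  qed
  moreover have "summable (\<lambda>n. q ^ n)"
    using q by (intro summable_geometric) simp
  ultimately have "summable (\<lambda>n. prob (A n))"
    by (intro summable_comparison_test'[of "\<lambda>n. q ^ n" 0 "\<lambda>n. prob (A n)"]) auto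
  then have "AE \<omega> in ?M. eventually (\<lambda>n. \<omega> \<in> space ?M - A n) sequentially"
    by (intro borel_cantelli_AE1) (auto simp: less_top[symmetric])
  moreover have "eventually (\<lambda>n. \<theta> * (total_profit x \<omega> n / real n) \<le> \<gamma>') sequentially"
    if "eventually (\<lambda>n. \<omega> \<in> space ?M - A n) sequentially" for \<omega>
  proof -
    obtain n0 :: nat where n0: "2 * H / \<epsilon> < real n0"
      using reals_Archimedean2 by blast
    show ?thesis
      using that eventually_ge_at_top[of "Suc n0"]
    proof eventually_elim
      case (elim n)
      have "l * (\<theta> * total_profit x \<omega> n + h (configuration x \<omega> n) - h x) <
          l * (real n * (\<gamma> + 2 * \<epsilon>))"
        using elim by (auto simp: A_def W_def mult_ac)
      then have "\<theta> * total_profit x \<omega> n + h (configuration x \<omega> n) - h x < real n * (\<gamma> + 2 * \<epsilon>)"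
        using l by simp
      moreover have "\<bar>h (configuration x \<omega> n)\<bar> \<le> H" "\<bar>h x\<bar> \<le> H"
        by (intro H x configuration_in_configurations)+
      moreover have "2 * H \<le> real n * \<epsilon>"
      proof -
        have "2 * H \<le> real n0 * \<epsilon>" using n0 \<epsilon> by (simp add: field_simps)
        also have "\<dots> \<le> real n * \<epsilon>" using elim \<epsilon> by simp
        finally show ?thesis .
      qed
      ultimately have "\<theta> * total_profit x \<omega> n \<le> real n * (\<gamma> + 3 * \<epsilon>)"
        by (simp add: algebra_simps)
      then show ?case
        using elim by (simp add: \<epsilon>_def field_simps)
    qed
  qed
  ultimately show ?thesis by auto
qed

definition drift :: "nat \<Rightarrow> (nat \<Rightarrow> real) \<Rightarrow> bool list \<Rightarrow> real" where
  "drift N p x = measure_pmf.expectation (turn_input N p) (\<lambda>u. real_of_int (snd (play_turn x u)))"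

text \<open>
  Applied to \<open>h\<close> with \<open>\<theta> = 1\<close> and to \<open>- h\<close> with \<open>\<theta> = - 1\<close>, the one-sided bound confines the
  profit per turn eventually to any neighbourhood of \<open>\<mu>\<close>. The function \<open>h\<close> may depend on \<open>\<epsilon>\<close>, since
  countably many \<open>\<epsilon>\<close> suffice for the almost sure limit.
\<close>

lemma has_mean_profitI:
  assumes N: "N > 0"
    and approx: "\<And>\<epsilon>. \<epsilon> > 0 \<Longrightarrow> \<exists>h. \<forall>x\<in>configurations N.
        \<bar>drift N p x + next_mean N p h x - h x - \<mu>\<bar> \<le> \<epsilon>"
  shows "has_mean_profit N p \<mu>"
proof -
  let ?M = "stream_space (measure_pmf (turn_input N p))"
  interpret M: prob_space ?M
    by (rule prob_space.prob_space_stream_space) (rule prob_space_measure_pmf)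
  have AE_lim: "AE \<omega> in ?M. (\<lambda>n. total_profit x \<omega> n / real n) \<longlonglongrightarrow> \<mu>"
    if x: "x \<in> configurations N" for x
  proof -
    have "AE \<omega> in ?M. eventually (\<lambda>n. \<bar>total_profit x \<omega> n / real n - \<mu>\<bar> \<le> 1 / Suc k) sequentially" for k
    proof -
      define \<epsilon> :: real where "\<epsilon> = 1 / Suc k / 2"
      have \<epsilon>: "\<epsilon> > 0" "\<epsilon> < 1 / Suc k" by (simp_all add: \<epsilon>_def field_simps)
      obtain h where h: "\<And>y. y \<in> configurations N \<Longrightarrow>
          \<bar>drift N p y + next_mean N p h y - h y - \<mu>\<bar> \<le> \<epsilon>"
        using approx[OF \<epsilon>(1)] by blast
      have mean: "measure_pmf.expectation (turn_input N p)
          (\<lambda>u. \<theta> * snd (play_turn y u) + \<theta> * h (fst (play_turn y u)) - \<theta> * h y)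
          = \<theta> * (drift N p y + next_mean N p h y - h y)" for \<theta> :: real and y
        by (simp add: drift_def next_mean_def integrable_turn_input[OF N] algebra_simps)
      have "AE \<omega> in ?M. eventually (\<lambda>n. 1 * (total_profit x \<omega> n / real n) \<le> \<mu> + 1 / Suc k) sequentially"
      proof (rule AE_profit_upper_bound[OF N, where \<gamma> = "\<mu> + \<epsilon>" and h = "\<lambda>y. 1 * h y"])
        show "measure_pmf.expectation (turn_input N p)
          (\<lambda>u. 1 * real_of_int (snd (play_turn y u)) + 1 * h (fst (play_turn y u)) - 1 * h y) \<le> \<mu> + \<epsilon>"
          if "y \<in> configurations N" for y
          using h[OF that] by (subst mean) auto
      qed (use x \<epsilon> in auto)
      moreover have "AE \<omega> in ?M. eventually (\<lambda>n. -1 * (total_profit x \<omega> n / real n) \<le> - \<mu> + 1 / Suc k) sequentially"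
      proof (rule AE_profit_upper_bound[OF N, where \<gamma> = "- \<mu> + \<epsilon>" and h = "\<lambda>y. -1 * h y"])
        show "measure_pmf.expectation (turn_input N p)
          (\<lambda>u. -1 * real_of_int (snd (play_turn y u)) + -1 * h (fst (play_turn y u)) - -1 * h y) \<le> - \<mu> + \<epsilon>"
          if "y \<in> configurations N" for y
          using h[OF that] by (subst mean) auto
      qed (use x \<epsilon> in auto)
      ultimately show ?thesis
      proof eventually_elim
        case (elim \<omega>)
        from elim show ?case
          by eventually_elim auto
      qed
    qed
    then have "AE \<omega> in ?M. \<forall>k. eventually (\<lambda>n. \<bar>total_profit x \<omega> n / real n - \<mu>\<bar> \<le> 1 / Suc k) sequentially"
      by (simp add: AE_all_countable)
    then show ?thesis
    proof eventually_elim
      case (elim \<omega>)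
      show ?case
      proof (rule tendstoI)
        fix e :: real
        assume "e > 0"
        then obtain k where k: "1 / Suc k < e"
          using nat_approx_posE by blast
        show "eventually (\<lambda>n. dist (total_profit x \<omega> n / real n) \<mu> < e) sequentially"
          using elim[rule_format, of k] by eventually_elim (use k in \<open>auto simp: dist_real_def\<close>)
      qed
    qed
  qed
  show ?thesis
    unfolding has_mean_profit_def
  proof (intro allI impI)
    fix init :: "bool list pmf"
    assume init: "set_pmf init \<subseteq> {x. length x = N}"
    interpret pair_sigma_finite "measure_pmf init" ?M ..
    let ?P = "\<lambda>z. (\<lambda>n. total_profit (fst z) (snd z) n / real n) \<longlonglongrightarrow> \<mu>"
    have meas: "(\<lambda>z. real_of_int (total_profit (fst z) (snd z) n) / real n) \<in>
        borel_measurable (measure_pmf init \<Otimes>\<^sub>M ?M)" for n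
    proof -
      have "(\<lambda>z. real_of_int (total_profit (fst z) (snd z) n) / real n) \<in>
        borel_measurable (count_space UNIV \<Otimes>\<^sub>M ?M)"
        by (rule measurable_pair_measure_countable1) (auto, measurable)
      then show ?thesis
        by (simp add: measurable_def space_pair_measure sets_pair_measure)
    qed
    have "AE z in measure_pmf init \<Otimes>\<^sub>M ?M. ?P z"
    proof (rule AE_pair_measure)
      note [measurable] = meas
      show "{z \<in> space (measure_pmf init \<Otimes>\<^sub>M ?M). ?P z} \<in> sets (measure_pmf init \<Otimes>\<^sub>M ?M)"
        by measurable
      show "AE x in measure_pmf init. AE \<omega> in ?M. ?P (x, \<omega>)"
        using init AE_lim by (auto simp: AE_measure_pmf_iff configurations_def)
    qed
    then show "AE (x, \<omega>) in game_space N p init. (\<lambda>n. total_profit x \<omega> n / real n) \<longlonglongrightarrow> \<mu>"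
      by (simp only: game_space_def case_prod_unfold)
  qed
qed

text \<open>
  The limit is unique because almost sure limits on a probability space are, and there is at least
  one initial law.
\<close>

lemma mean_profit_eqI:
  assumes "has_mean_profit N p \<mu>"
  shows "mean_profit N p = \<mu>"
  unfolding mean_profit_def
proof (rule the_equality)
  fix \<nu>
  assume \<nu>: "has_mean_profit N p \<nu>"
  define init where "init = return_pmf (replicate N True)"
  have init: "set_pmf init \<subseteq> {x. length x = N}" by (simp add: init_def)
  interpret S: prob_space "stream_space (measure_pmf (turn_input N p))"
    by (rule prob_space.prob_space_stream_space) (rule prob_space_measure_pmf)
  interpret I: prob_space "measure_pmf init" by (rule prob_space_measure_pmf)
  interpret pair_prob_space "measure_pmf init" "stream_space (measure_pmf (turn_input N p))" ..
  have "prob_space (game_space N p init)"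
    unfolding game_space_def by (rule prob_space_axioms)
  then interpret G: prob_space "game_space N p init" .
  have "AE (x, \<omega>) in game_space N p init. (\<lambda>n. total_profit x \<omega> n / real n) \<longlonglongrightarrow> \<mu>"
    and "AE (x, \<omega>) in game_space N p init. (\<lambda>n. total_profit x \<omega> n / real n) \<longlonglongrightarrow> \<nu>"
    using assms \<nu> init by (auto simp: has_mean_profit_def)
  then have "AE z in game_space N p init. \<mu> = \<nu>"
    by eventually_elim (auto intro: LIMSEQ_unique)
  then show "\<nu> = \<mu>"
    by simp
qed fact

section \<open>Drift and discord\<close>

definition winners :: "bool list \<Rightarrow> real" where
  "winners x = (\<Sum>i<length x. of_bool (x ! i))"

definition left_neighbour :: "bool list \<Rightarrow> nat \<Rightarrow> bool" where
  "left_neighbour x i = x ! ((i + length x - 1) mod length x)"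

definition right_neighbour :: "bool list \<Rightarrow> nat \<Rightarrow> bool" where
  "right_neighbour x i = x ! ((i + 1) mod length x)"

definition discord :: "bool list \<Rightarrow> real" where
  "discord x = (\<Sum>i<length x. of_bool (left_neighbour x i \<noteq> right_neighbour x i))"

lemma neighbour_index_eq:
  "neighbour_index x i = 2 * of_bool (left_neighbour x i) + of_bool (right_neighbour x i)"
  by (simp add: neighbour_index_def left_neighbour_def right_neighbour_def)

lemma coin_of_neighbours:
  "p (neighbour_index x i) =
    (if left_neighbour x i then if right_neighbour x i then p 3 else p 2
     else if right_neighbour x i then p 1 else p 0)"
  by (simp add: neighbour_index_eq numeral_2_eq_2 numeral_3_eq_3)

lemma neighbour_index_less_4: "neighbour_index x i < 4"
  by (simp add: neighbour_index_def)

lemma less_4_cases: "m < 4 \<Longrightarrow> m = 0 \<or> m = 1 \<or> m = 2 \<or> m = 3" for m :: nat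
  by auto

lemma mod_circle:
  fixes i N :: nat
  assumes "i < N"
  shows "((i + 1) mod N + N - 1) mod N = i" and "((i + N - 1) mod N + 1) mod N = i"
proof -
  show "((i + 1) mod N + N - 1) mod N = i"
    using assms by (cases "Suc i = N") auto
  show "((i + N - 1) mod N + 1) mod N = i"
  proof (cases i)
    case (Suc j)
    then have "(i + N - 1) mod N = j" using assms by simp
    then show ?thesis using Suc assms by simp
  qed (use assms in simp)
qed

text \<open>
  Every player is the left neighbour of exactly one player and the right neighbour of exactly one.
\<close>

lemma sum_left_neighbour: "(\<Sum>i<length x. of_bool (left_neighbour x i)) = winners x"
  unfolding winners_def left_neighbour_def
  by (rule sum.reindex_bij_witness[of _ "\<lambda>i. (i + 1) mod length x" "\<lambda>i. (i + length x - 1) mod length x"])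
     (auto simp: mod_circle simp del: One_nat_def intro!: mod_less_divisor)

lemma sum_right_neighbour: "(\<Sum>i<length x. of_bool (right_neighbour x i)) = winners x"
  unfolding winners_def right_neighbour_def
  by (rule sum.reindex_bij_witness[of _ "\<lambda>i. (i + length x - 1) mod length x" "\<lambda>i. (i + 1) mod length x"])
     (auto simp: mod_circle simp del: One_nat_def intro!: mod_less_divisor)

lemma winners_update:
  assumes "i < length x"
  shows "winners (x[i := v]) = winners x + of_bool v - of_bool (x ! i)"
proof -
  have "winners (x[i := v]) = of_bool v + (\<Sum>j\<in>{..<length x} - {i}. of_bool (x ! j))"
    unfolding winners_def length_list_update using assms
    by (subst sum.remove[of _ i]) (auto intro!: sum.cong)
  moreover have "winners x = of_bool (x ! i) + (\<Sum>j\<in>{..<length x} - {i}. of_bool (x ! j))"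
    unfolding winners_def using assms by (subst sum.remove[of _ i]) auto
  ultimately show ?thesis by simp
qed

text \<open>
  The hypotheses shared by games \<open>B\<close> and \<open>C\<close>: mixing with the fair game preserves
  \<open>p\<^sub>0 + p\<^sub>3 = 1\<close> and \<open>p\<^sub>1 = p\<^sub>2\<close>.
\<close>

locale symmetric_game =
  fixes N :: nat and p :: "nat \<Rightarrow> real"
  assumes N_pos: "N > 0"
    and prob: "\<And>m. m < 4 \<Longrightarrow> p m \<in> {0..1}"
    and p0_p3: "p 0 + p 3 = 1" and p1_p2: "p 1 = p 2"
    and p0_pos: "p 0 > 0"
begin

lemma win_minus_loss_chance:
  "2 * p (neighbour_index x i) - 1 =
     (2 * p 0 - 1) * (1 - of_bool (left_neighbour x i) - of_bool (right_neighbour x i))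
     + (2 * p 1 - 1) * of_bool (left_neighbour x i \<noteq> right_neighbour x i)"
proof -
  have p3: "p 3 = 1 - p 0" using p0_p3 by simp
  show ?thesis
    by (cases "left_neighbour x i"; cases "right_neighbour x i")
      (simp_all add: coin_of_neighbours p3 p1_p2[symmetric])
qed

text \<open>
  With \<open>Q\<close> the sum of the winning chances over the players, \<open>N g = 2 Q - N\<close> and
  \<open>N (P k - k) = Q - k\<close>. Comparing \<open>2 Q - N\<close> with the sum of the formula for a single player
  around the circle eliminates the number of winners \<open>k\<close>.
\<close>

lemma drift_eq:
  assumes x: "x \<in> configurations N"
  shows "drift N p x =
    (2 * p 0 - 1) / p 0 * (next_mean N p winners x - winners x)
    + (2 * p 1 - 1) / (2 * p 0 * real N) * discord x"
proof -
  have len: "length x = N" using x by (simp add: configurations_def)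
  define Q where "Q = (\<Sum>i<N. p (neighbour_index x i))"
  have "drift N p x = (\<Sum>i<N. 2 * p (neighbour_index x i) - 1) / N"
    unfolding drift_def
    using expectation_play_turn[OF N_pos prob, where F = "\<lambda>z. real_of_int (snd z)"]
    by simp
  then have d: "real N * drift N p x = 2 * Q - real N"
    using N_pos by (simp add: Q_def sum_subtractf sum_distrib_left)
  have "next_mean N p winners x =
      (\<Sum>i<N. winners x + (p (neighbour_index x i) - of_bool (x ! i))) / N"
    unfolding next_mean_def
    using expectation_play_turn[OF N_pos prob, where F = "\<lambda>z. winners (fst z)"]
    by (simp add: winners_update len algebra_simps)
  also have "\<dots> = (N * winners x + (Q - winners x)) / N"
    by (simp add: sum.distrib sum_subtractf Q_def winners_def len)
  finally have w: "real N * (next_mean N p winners x - winners x) = Q - winners x"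
    using N_pos by (simp add: field_simps)
  have "2 * Q - real N = (\<Sum>i<N. 2 * p (neighbour_index x i) - 1)"
    by (simp add: Q_def sum_subtractf sum_distrib_left)
  also have "\<dots> = (2 * p 0 - 1) * (real N - winners x - winners x) + (2 * p 1 - 1) * discord x"
    unfolding win_minus_loss_chance
    using sum_left_neighbour[of x] sum_right_neighbour[of x]
    by (simp add: sum.distrib sum_subtractf discord_def len flip: sum_distrib_left)
  finally have "2 * Q - real N =
      (2 * p 0 - 1) * (real N - 2 * winners x) + (2 * p 1 - 1) * discord x"
    by (simp add: algebra_simps)
  then have "2 * p 0 * (2 * Q - real N) =
      (2 * p 0 - 1) * (real N - 2 * winners x) + (2 * p 1 - 1) * discord x
      + (2 * p 0 - 1) * (2 * Q - real N)"
    by (simp add: algebra_simps)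
  also have "\<dots> = 2 * (2 * p 0 - 1) * (Q - winners x) + (2 * p 1 - 1) * discord x"
    by (simp add: algebra_simps)
  finally have "2 * p 0 * (real N * drift N p x) =
      2 * (2 * p 0 - 1) * (real N * (next_mean N p winners x - winners x)) + (2 * p 1 - 1) * discord x"
    by (simp only: d w)
  then have "drift N p x = (2 * (2 * p 0 - 1) * (real N * (next_mean N p winners x - winners x))
      + (2 * p 1 - 1) * discord x) / (2 * p 0 * real N)"
    using N_pos p0_pos by (simp add: nonzero_eq_divide_eq mult_ac)
  then show ?thesis
    using N_pos p0_pos by (simp add: add_divide_distrib) (simp add: field_simps)
qed

text \<open>
  The function \<open>h\<close> is chosen to cancel the telescoping part of the drift and to replace \<open>D\<close> by
  \<open>P\<^sup>n D\<close>, which is uniformly close to its limit because there are finitely many configurations.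
\<close>

lemma has_mean_profit_if_discord_converges:
  assumes lim: "\<And>x. x \<in> configurations N \<Longrightarrow> (\<lambda>n. (next_mean N p ^^ n) discord x) \<longlonglongrightarrow> c"
  shows "has_mean_profit N p ((2 * p 1 - 1) / (2 * p 0 * real N) * c)"
proof (rule has_mean_profitI[OF N_pos])
  fix \<epsilon> :: real
  assume \<epsilon>: "\<epsilon> > 0"
  define \<alpha> where "\<alpha> = (2 * p 0 - 1) / p 0"
  define \<beta> where "\<beta> = (2 * p 1 - 1) / (2 * p 0 * real N)"
  define D where "D n = (next_mean N p ^^ n) discord" for n
  have "eventually (\<lambda>n. \<forall>x\<in>configurations N. \<bar>\<beta> * D n x - \<beta> * c\<bar> < \<epsilon>) sequentially"
  proof (rule eventually_ball_finite[OF finite_configurations], rule ballI)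
    fix x
    assume "x \<in> configurations N"
    then have "(\<lambda>n. \<beta> * D n x) \<longlonglongrightarrow> \<beta> * c"
      unfolding D_def by (intro tendsto_intros lim)
    then show "eventually (\<lambda>n. \<bar>\<beta> * D n x - \<beta> * c\<bar> < \<epsilon>) sequentially"
      using \<epsilon> by (auto dest!: tendstoD simp: dist_real_def)
  qed
  then obtain n where n: "\<And>x. x \<in> configurations N \<Longrightarrow> \<bar>\<beta> * D n x - \<beta> * c\<bar> < \<epsilon>"
    by (metis (no_types, lifting) eventually_at_top_linorder order_refl)
  define h where "h x = - \<alpha> * winners x + \<beta> * (\<Sum>k<n. D k x)" for x
  have "drift N p x + next_mean N p h x - h x = \<beta> * D n x" if "x \<in> configurations N" for x
  proof -
    have "next_mean N p h x = - \<alpha> * next_mean N p winners x + \<beta> * (\<Sum>k<n. next_mean N p (D k) x)"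
      unfolding h_def[abs_def]
      by (simp only: next_mean_add[OF N_pos] next_mean_cmult[OF N_pos] next_mean_sum[OF N_pos])
    moreover have "drift N p x = \<alpha> * (next_mean N p winners x - winners x) + \<beta> * D 0 x"
      using drift_eq[OF that] by (simp add: \<alpha>_def \<beta>_def D_def)
    moreover have "\<beta> * ((\<Sum>k<n. next_mean N p (D k) x) - (\<Sum>k<n. D k x)) = \<beta> * (D n x - D 0 x)"
      using sum_lessThan_telescope[of "\<lambda>k. D k x" n] by (simp add: D_def sum_subtractf)
    ultimately show ?thesis
      by (simp add: h_def right_diff_distrib)
  qed
  then show "\<exists>h. \<forall>x\<in>configurations N.
      \<bar>drift N p x + next_mean N p h x - h x - (2 * p 1 - 1) / (2 * p 0 * real N) * c\<bar> \<le> \<epsilon>"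
    unfolding \<beta>_def[symmetric] using n by (intro exI[of _ h]) (auto intro: less_imp_le)
qed

end

section \<open>Steering the game to a chosen configuration\<close>

text \<open>
  \<open>steers p \<kappa> n x y\<close>: some choice of \<open>n\<close> players and results leads from \<open>x\<close> to \<open>y\<close>, every result
  having conditional probability at least \<open>\<kappa>\<close>. The number of turns is recorded because the
  contraction argument needs the same number from all configurations.
\<close>

inductive steers :: "(nat \<Rightarrow> real) \<Rightarrow> real \<Rightarrow> nat \<Rightarrow> bool list \<Rightarrow> bool list \<Rightarrow> bool"
  for p \<kappa> where
  start: "steers p \<kappa> 0 x x"
| turn: "steers p \<kappa> n x y \<Longrightarrow> i < length y \<Longrightarrow>
    \<kappa> \<le> (if v then p (neighbour_index y i) else 1 - p (neighbour_index y i)) \<Longrightarrow>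
    steers p \<kappa> (Suc n) x (y[i := v])"

lemma steers_trans:
  assumes "steers p \<kappa> m y z" and "steers p \<kappa> n x y"
  shows "steers p \<kappa> (n + m) x z"
  using assms by induction (auto intro: steers.turn)

text \<open>
  Player \<open>j + 1\<close> is made to differ from player \<open>j\<close>. Against a loser on the left his coin is \<open>p\<^sub>0\<close>
  or \<open>p\<^sub>1\<close> and he has to win; against a winner it is \<open>p\<^sub>2\<close> or \<open>p\<^sub>3\<close> and he has to lose. The four
  hypotheses say that the required result has chance at least \<open>\<kappa>\<close> in each case.
\<close>

lemma steers_zigzag:
  assumes \<kappa>: "\<kappa> \<le> p 0" "\<kappa> \<le> p 1" "\<kappa> \<le> 1 - p 2" "\<kappa> \<le> 1 - p 3"
    and j: "j < length x"
  shows "steers p \<kappa> j x (map (\<lambda>i. if i \<le> j then x ! 0 \<noteq> odd i else x ! i) [0..<length x])"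
  using j
proof (induction j)
  case 0
  have "map (\<lambda>i. if i \<le> 0 then x ! 0 \<noteq> odd i else x ! i) [0..<length x] = x"
    by (rule nth_equalityI) auto
  then show ?case by (simp add: steers.start)
next
  case (Suc j)
  define y where "y = map (\<lambda>i. if i \<le> j then x ! 0 \<noteq> odd i else x ! i) [0..<length x]"
  have "left_neighbour y (Suc j) = (x ! 0 \<noteq> odd j)"
    using Suc.prems by (simp add: left_neighbour_def y_def)
  then have "\<kappa> \<le> (if x ! 0 \<noteq> odd (Suc j) then p (neighbour_index y (Suc j))
      else 1 - p (neighbour_index y (Suc j)))"
    using \<kappa> by (simp add: coin_of_neighbours)
  then have "steers p \<kappa> (Suc j) x (y[Suc j := x ! 0 \<noteq> odd (Suc j)])"
    using Suc by (intro steers.turn) (simp_all add: y_def)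
  moreover have "y[Suc j := x ! 0 \<noteq> odd (Suc j)] =
      map (\<lambda>i. if i \<le> Suc j then x ! 0 \<noteq> odd i else x ! i) [0..<length x]"
    using Suc.prems by (intro nth_equalityI) (auto simp: y_def nth_list_update)
  ultimately show ?case by simp
qed

definition zigzag :: "nat \<Rightarrow> bool \<Rightarrow> bool list" where
  "zigzag N b = map (\<lambda>i. b \<noteq> odd i) [0..<N]"

lemma length_zigzag [simp]: "length (zigzag N b) = N"
  by (simp add: zigzag_def)

lemma nth_zigzag [simp]: "i < N \<Longrightarrow> zigzag N b ! i = (b \<noteq> odd i)"
  by (simp add: zigzag_def)

lemma steers_to_zigzag:
  assumes "\<kappa> \<le> p 0" "\<kappa> \<le> p 1" "\<kappa> \<le> 1 - p 2" "\<kappa> \<le> 1 - p 3" and "x \<noteq> []"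
  shows "steers p \<kappa> (length x - 1) x (zigzag (length x) (x ! 0))"
proof -
  have "map (\<lambda>i. if i \<le> length x - 1 then x ! 0 \<noteq> odd i else x ! i) [0..<length x] =
      zigzag (length x) (x ! 0)"
    by (rule nth_equalityI) (use assms(5) in auto)
  then show ?thesis
    using steers_zigzag[of \<kappa> p "length x - 1" x] assms by simp
qed

text \<open>
  For odd length, player \<open>0\<close> of an alternating configuration has one winning and one losing
  neighbour (the defect of the alternation is next to him), so either result of his is possible.
  He is made a winner, and a second round restores the alternation.
\<close>

lemma steers_to_zigzag_True:
  assumes \<kappa>: "\<kappa> \<le> p 0" "\<kappa> \<le> p 1" "\<kappa> \<le> p 2" "\<kappa> \<le> 1 - p 2" "\<kappa> \<le> 1 - p 3"
    and odd: "odd (length x)" and N: "length x \<ge> 3"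
  shows "steers p \<kappa> (length x - 1 + 1 + (length x - 1)) x (zigzag (length x) True)"
proof -
  define y where "y = zigzag (length x) (x ! 0)"
  define z where "z = y[0 := True]"
  have x: "x \<noteq> []"
    using N by (cases x) simp_all
  have l: "left_neighbour y 0 = (x ! 0)" and r: "right_neighbour y 0 = (\<not> x ! 0)"
    using odd N by (simp_all add: left_neighbour_def right_neighbour_def y_def)
  have "steers p \<kappa> (length x - 1) x y"
    unfolding y_def by (intro steers_to_zigzag \<kappa> x)
  then have "steers p \<kappa> (Suc (length x - 1)) x z"
    unfolding z_def
  proof (rule steers.turn)
    show "0 < length y" using x by (simp add: y_def)
    show "\<kappa> \<le> (if True then p (neighbour_index y 0) else 1 - p (neighbour_index y 0))"
      using \<kappa> l r by (simp add: coin_of_neighbours)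
  qed
  moreover have "steers p \<kappa> (length x - 1) z (zigzag (length x) True)"
  proof -
    have "length z = length x" "z ! 0" "z \<noteq> []"
      using x by (auto simp: z_def y_def simp flip: length_greater_0_conv)
    then show ?thesis
      using steers_to_zigzag[of \<kappa> p z] \<kappa> by simp
  qed
  ultimately show ?thesis
    using steers_trans by fastforce
qed

lemma steers_overwrite:
  assumes \<kappa>: "\<And>m. m < 4 \<Longrightarrow> \<kappa> \<le> p m \<and> \<kappa> \<le> 1 - p m"
    and len: "length z = length x" and j: "j \<le> length x"
  shows "steers p \<kappa> j x (take j z @ drop j x)"
  using j
proof (induction j)
  case 0
  then show ?case by (simp add: steers.start)
next
  case (Suc j)
  have "steers p \<kappa> (Suc j) x ((take j z @ drop j x)[j := z ! j])"
    using Suc len \<kappa>[OF neighbour_index_less_4] by (intro steers.turn) auto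
  moreover have "(take j z @ drop j x)[j := z ! j] = take (Suc j) z @ drop (Suc j) x"
    using Suc.prems len
    by (intro nth_equalityI) (auto simp: nth_list_update nth_append less_Suc_eq min_def)
  ultimately show ?case by simp
qed

section \<open>The sign of the mean profit\<close>

context symmetric_game
begin

lemma next_mean_ge_outcome:
  assumes x: "x \<in> configurations N" and i: "i < N"
    and g: "\<forall>y\<in>configurations N. 0 \<le> g y"
    and \<kappa>: "\<kappa> \<le> (if v then p (neighbour_index x i) else 1 - p (neighbour_index x i))"
  shows "\<kappa> / N * g (x[i := v]) \<le> next_mean N p g x"
proof -
  define T where "T j = p (neighbour_index x j) * g (x[j := True])
           + (1 - p (neighbour_index x j)) * g (x[j := False])" for j
  have g0: "0 \<le> g (x[j := w])" for j w
    using g x by (simp add: configurations_def)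
  have prob': "0 \<le> p (neighbour_index x j)" "p (neighbour_index x j) \<le> 1" for j
    using prob[OF neighbour_index_less_4] by auto
  have "\<kappa> * g (x[i := v]) \<le> (if v then p (neighbour_index x i) else 1 - p (neighbour_index x i)) * g (x[i := v])"
    by (intro mult_right_mono \<kappa> g0)
  also have "\<dots> \<le> T i"
    using g0 prob' by (simp add: T_def)
  also have "\<dots> \<le> (\<Sum>j<N. T j)"
    using i g0 prob' by (intro member_le_sum) (auto simp: T_def)
  also have "\<dots> = N * next_mean N p g x"
    unfolding next_mean_def
    using expectation_play_turn[OF N_pos prob, where F = "\<lambda>z. g (fst z)"] N_pos
    by (simp add: T_def)
  finally show ?thesis
    using N_pos by (simp add: field_simps)
qed

lemma iterate_ge_steered:
  assumes "steers p \<kappa> n x y" and \<kappa>: "\<kappa> \<ge> 0" and "x \<in> configurations N"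
    and "\<forall>y\<in>configurations N. 0 \<le> g y"
  shows "(\<kappa> / N) ^ n * g y \<le> (next_mean N p ^^ n) g x \<and> y \<in> configurations N"
  using assms(1,3,4)
proof (induction arbitrary: g)
  case (turn n x y i v)
  define g' where "g' = next_mean N p g"
  have "\<forall>y\<in>configurations N. 0 \<le> g' y"
    using iterate_ge[OF N_pos, where a = 0 and f = g and n = 1] turn.prems by (simp add: g'_def)
  with turn have IH: "(\<kappa> / N) ^ n * g' y \<le> (next_mean N p ^^ n) g' x" and y: "y \<in> configurations N"
    by auto
  have "\<kappa> / N * g (y[i := v]) \<le> g' y"
    unfolding g'_def using y turn by (intro next_mean_ge_outcome) (auto simp: configurations_def)
  then have "(\<kappa> / N) ^ n * (\<kappa> / N * g (y[i := v])) \<le> (\<kappa> / N) ^ n * g' y"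
    using \<kappa> by (intro mult_left_mono) auto
  with IH y show ?case
    by (simp add: g'_def funpow_swap1 configurations_def mult_ac)
qed simp

text \<open>
  After \<open>L\<close> turns the mean discord is at least \<open>\<delta> D z\<close> from every start, and averages of such
  values keep that lower bound; hence so does the limit.
\<close>

lemma mean_profit_pos:
  assumes p1: "p 1 > 1/2" and \<kappa>: "\<kappa> > 0"
    and z: "z \<in> configurations N" "discord z > 0"
    and steer: "\<And>x. x \<in> configurations N \<Longrightarrow> steers p \<kappa> L x z"
  shows "mean_profit N p > 0"
proof -
  define \<delta> where "\<delta> = (\<kappa> / N) ^ L"
  have \<delta>: "\<delta> > 0" using \<kappa> N_pos by (simp add: \<delta>_def)
  have visit: "\<delta> * g z \<le> (next_mean N p ^^ L) g x"
    if "x \<in> configurations N" "\<forall>y\<in>configurations N. 0 \<le> g y" for x g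
    using iterate_ge_steered[OF steer] that \<kappa> by (simp add: \<delta>_def)
  obtain c where c: "\<And>x. x \<in> configurations N \<Longrightarrow> (\<lambda>n. (next_mean N p ^^ n) discord x) \<longlonglongrightarrow> c"
    by (rule iterate_converges[OF N_pos, where Z = "{z}" and \<delta> = \<delta> and L = L and f = discord]) (use z \<delta> visit in auto)
  have "\<delta> * discord z \<le> (next_mean N p ^^ (n + L)) discord z" for n
    unfolding funpow_add comp_def
    by (intro iterate_ge[OF N_pos] visit z ballI) (simp_all add: discord_def sum_nonneg)
  then have "\<delta> * discord z \<le> c"
    by (intro LIMSEQ_le_const[OF LIMSEQ_ignore_initial_segment[OF c[OF z(1)], of L]]) auto
  moreover have "0 < \<delta> * discord z"
    using \<delta> z by simp
  ultimately have "c > 0" by linarith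
  then show ?thesis
    using mean_profit_eqI[OF has_mean_profit_if_discord_converges[OF c]] p1 p0_pos N_pos by simp
qed

end

lemma neighbours_zigzag:
  assumes "even N" and "i < N"
  shows "left_neighbour (zigzag N b) i = (\<not> zigzag N b ! i)"
    and "right_neighbour (zigzag N b) i = (\<not> zigzag N b ! i)"
proof -
  have "0 < N" using assms by simp
  then have m: "k mod N < N" "odd (k mod N) = odd k" for k
    using assms(1) by (simp_all add: dvd_mod_iff)
  show "left_neighbour (zigzag N b) i = (\<not> zigzag N b ! i)"
    using assms m by (simp add: left_neighbour_def)
  show "right_neighbour (zigzag N b) i = (\<not> zigzag N b ! i)"
    using assms m by (simp add: right_neighbour_def del: One_nat_def)
qed

text \<open>
  Alternating configurations are absorbing: a winner has two losing neighbours and wins for sure, a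
  loser has two winning neighbours and loses for sure.
\<close>

lemma (in symmetric_game) next_mean_zigzag:
  assumes p0: "p 0 = 1" and "even N"
  shows "next_mean N p f (zigzag N b) = f (zigzag N b)"
proof -
  let ?z = "zigzag N b"
  have p3: "p 3 = 0" using p0 p0_p3 by simp
  have "p (neighbour_index ?z i) * f (?z[i := True])
           + (1 - p (neighbour_index ?z i)) * f (?z[i := False]) = f ?z" if "i < N" for i
  proof (cases "?z ! i")
    case True
    then have "?z[i := True] = ?z" by (metis list_update_id)
    moreover have "p (neighbour_index ?z i) = 1"
      using True neighbours_zigzag[OF \<open>even N\<close> that, of b] by (simp add: coin_of_neighbours p0)
    ultimately show ?thesis by simp
  next
    case False
    then have "?z[i := False] = ?z" by (metis list_update_id)
    moreover have "p (neighbour_index ?z i) = 0"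
      using False neighbours_zigzag[OF \<open>even N\<close> that, of b] by (simp add: coin_of_neighbours p3)
    ultimately show ?thesis by simp
  qed
  then show ?thesis
    unfolding next_mean_def
    using expectation_play_turn[OF N_pos prob, where F = "\<lambda>z. f (fst z)"] N_pos by simp
qed

lemma mean_profit_zero:
  assumes p: "p 0 = 1" "p 1 = p 2" "p 1 \<in> {1/2<..<1}" "p 3 = 0"
    and N: "N > 0" "even N"
  shows "mean_profit N p = 0"
proof -
  interpret symmetric_game N p
    by unfold_locales (use p N in \<open>auto dest!: less_4_cases\<close>)
  let ?Z = "{zigzag N True, zigzag N False}"
  define \<kappa> where "\<kappa> = 1 - p 1"
  have \<kappa>: "\<kappa> > 0" using p by (simp add: \<kappa>_def)
  have fixed: "(next_mean N p ^^ n) f z = f z" if "z \<in> ?Z" for n f z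
    using that by (induction n) (auto simp: next_mean_zigzag[OF p(1) N(2)])
  have discord: "discord z = 0" if "z \<in> ?Z" for z
    using that neighbours_zigzag[OF N(2)] by (auto simp: discord_def)
  have visit: "\<exists>z\<in>?Z. \<forall>g. (\<forall>y\<in>configurations N. 0 \<le> g y) \<longrightarrow>
      (\<kappa> / N) ^ (N - 1) * g z \<le> (next_mean N p ^^ (N - 1)) g x" if x: "x \<in> configurations N" for x
  proof -
    have len: "length x = N" using x by (simp add: configurations_def)
    have "steers p \<kappa> (length x - 1) x (zigzag (length x) (x ! 0))"
      by (rule steers_to_zigzag) (use p N len in \<open>auto simp: \<kappa>_def\<close>)
    then have "steers p \<kappa> (N - 1) x (zigzag N (x ! 0))"
      by (simp only: len)
    moreover have "zigzag N (x ! 0) \<in> ?Z"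
      by (cases "x ! 0") auto
    ultimately show ?thesis
      using iterate_ge_steered x \<kappa> by (meson less_imp_le)
  qed
  obtain c where c: "\<And>x. x \<in> configurations N \<Longrightarrow> (\<lambda>n. (next_mean N p ^^ n) discord x) \<longlonglongrightarrow> c"
  proof (rule iterate_converges[OF N_pos, where Z = ?Z and \<delta> = "(\<kappa> / N) ^ (N - 1)" and L = "N - 1"
        and f = discord])
    show "(\<kappa> / N) ^ (N - 1) > 0" using \<kappa> N by simp
  qed (use visit fixed discord in auto)
  \<comment> \<open>The iterates vanish at the absorbing configurations, so their limit is zero.\<close>
  have "zigzag N True \<in> configurations N"
    by (simp add: configurations_def)
  from c[OF this] have "c = 0"
    by (simp add: fixed discord LIMSEQ_const_iff)
  then show ?thesis
    using mean_profit_eqI[OF has_mean_profit_if_discord_converges[OF c]] by simp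
qed

lemma discord_pos:
  assumes "i < length x" and "left_neighbour x i \<noteq> right_neighbour x i"
  shows "discord x > 0"
  unfolding discord_def by (rule sum_pos2[of _ i]) (use assms in auto)

lemma mean_profit_pos_odd:
  assumes p: "p 0 = 1" "p 1 = p 2" "p 1 \<in> {1/2<..<1}" "p 3 = 0"
    and N: "N \<ge> 3" "odd N"
  shows "mean_profit N p > 0"
proof -
  interpret symmetric_game N p
    by unfold_locales (use p N in \<open>auto dest!: less_4_cases\<close>)
  show ?thesis
  proof (rule mean_profit_pos[where \<kappa> = "1 - p 1"])
    show "zigzag N True \<in> configurations N" by (simp add: configurations_def)
    \<comment> \<open>Both ends of the alternation are winners, so player 0 sits between a winner and a loser.\<close>
    show "discord (zigzag N True) > 0"
      by (rule discord_pos[of 0]) (use N in \<open>auto simp: left_neighbour_def right_neighbour_def\<close>)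
    show "steers p (1 - p 1) (N - 1 + 1 + (N - 1)) x (zigzag N True)" if "x \<in> configurations N" for x
      using steers_to_zigzag_True[of "1 - p 1" p x] that N p by (auto simp: configurations_def)
  qed (use p in auto)
qed

lemma mean_profit_pos_mixed:
  assumes p: "p 0 = 1" "p 1 = p 2" "p 1 \<in> {1/2<..<1}" "p 3 = 0"
    and N: "N \<ge> 3"
  shows "mean_profit N (mixed_game p) > 0"
proof -
  interpret symmetric_game N "mixed_game p"
    by unfold_locales (use p N in \<open>auto simp: mixed_game_def dest!: less_4_cases\<close>)
  \<comment> \<open>A single winner: player 1 sits between him and a loser.\<close>
  define z where "z = True # replicate (N - 1) False"
  have len: "length z = N" using N by (simp add: z_def)
  show ?thesis
  proof (rule mean_profit_pos[where \<kappa> = "1/4"])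
    show z: "z \<in> configurations N" by (simp add: configurations_def len)
    have "left_neighbour z 1" "\<not> right_neighbour z 1"
      using N unfolding left_neighbour_def right_neighbour_def len by (auto simp: z_def nth_Cons')
    then show "discord z > 0"
      using N by (intro discord_pos[of 1]) (auto simp: len)
    show "steers (mixed_game p) (1/4) N x z" if x: "x \<in> configurations N" for x
    proof -
      have "steers (mixed_game p) (1/4) N x (take N z @ drop N x)"
        by (rule steers_overwrite)
          (use x p in \<open>auto simp: configurations_def len mixed_game_def dest!: less_4_cases\<close>)
      then show ?thesis
        using x by (simp add: configurations_def len)
    qed
  qed (use p in \<open>auto simp: mixed_game_def\<close>)
qed

theorem theorem7:
  fixes p :: "nat \<Rightarrow> real"
  assumes "p 0 = 1"
    and "p 1 = p 2" and "p 1 \<in> {1/2<..<1}"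
    and "p 3 = 0"
  shows "(\<forall>N\<ge>4. even N \<longrightarrow> mean_profit N p = 0)
    \<and> (\<forall>N\<ge>3. odd N \<longrightarrow> mean_profit N p > 0)
    \<and> (\<forall>N\<ge>3. mean_profit N (mixed_game p) > 0)
    \<and> (\<forall>N\<ge>3. parrondo_effect N p \<longleftrightarrow> even N)"
proof -
  have B_even: "mean_profit N p = 0" if "N \<ge> 4" "even N" for N
    using that by (intro mean_profit_zero[OF assms]) auto
  have B_odd: "mean_profit N p > 0" if "N \<ge> 3" "odd N" for N
    using that by (rule mean_profit_pos_odd[OF assms])
  have C: "mean_profit N (mixed_game p) > 0" if "N \<ge> 3" for N
    using that by (rule mean_profit_pos_mixed[OF assms])
  have "parrondo_effect N p \<longleftrightarrow> even N" if "N \<ge> 3" for N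
  proof (cases "even N")
    case True
    with that have "N \<ge> 4" by (cases "N = 3") auto
    then show ?thesis
      using True C[OF that] B_even by (simp add: parrondo_effect_def)
  next
    case False
    then show ?thesis
      using that B_odd[of N] by (simp add: parrondo_effect_def)
  qed
  then show ?thesis
    using B_even B_odd C by blast
qed

end
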